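(* Let $c_1<c_2<\cdots<c_n$ be real numbers ($n\ge1$), and let $r_j=\sqrt{x^2+y^2+(z-c_j)^2}$ for $(x,y,z)\in\mathbb{R}^3$. Let $(M,g,J,\omega)$ be the toric Gibbons-Hawking space determined by the points $p_j=(0,0,c_j)$, with the $2$-torus action given in local coordinates by $$(e^{i\theta_1},e^{i\theta_2})\cdot(\varphi,x,y,z)=(\varphi+\theta_1,\ x\cos\theta_2-y\sin\theta_2,\ x\sin\theta_2+y\cos\theta_2,\ z).$$ Then $$\mu=(\mu_1,\mu_2)=\Bigl(-z,\ \frac12\sum_{j=1}^n(r_j+z-c_j)\Bigr)$$ is a moment map for this action, i.e. $d\mu_i=-\iota_{X_i}\omega$ for $i=1,2$, where $X_1=\frac{\partial}{\partial\varphi}$ and $X_2=-y\frac{\partial}{\partial x}+x\frac{\partial}{\partial y}$ generate the action. The image of $\mu$ is the convex region in $\mathbb{R}^2$ defined by the inequalities $$\mu_2+\sum_{j=1}^k(\mu_1+c_j)\ge 0,\qquad k=0,1,\dots,n.$$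
   Context: Put $V=\frac12\sum_{j=1}^n\frac1{r_j}$. Over $U=\mathbb{R}^3\setminus\{(0,0,z): z\ge c_1\}$ the space is $U\times S^1$, $e^{i\varphi}\in S^1$, with $$\alpha=-\frac12\sum_{j=1}^n\frac{x\,dy-y\,dx}{r_j(r_j-(z-c_j))},$$ $$g=\frac1V(d\varphi+\alpha)^2+V(dx^2+dy^2+dz^2),\qquad \omega=(d\varphi+\alpha)\wedge dz+V\,dx\wedge dy .$$ The full space $M$ is the smooth $4$-manifold with a circle action and map $\pi=(x,y,z):M\to\mathbb{R}^3$ which over $\mathbb{R}^3\setminus\{p_1,\dots,p_n\}$ is a principal $S^1$-bundle with connection form $d\varphi+\alpha$ (the local connection forms satisfying $d\alpha=-*dV$, with $*$ the Euclidean Hodge star), and which has exactly one (fixed) point over each $p_j$, over which $g$ and $\omega$ extend smoothly. The functions $\mu_1,\mu_2$ are pulled back from $\mathbb{R}^3$ by $\pi$; the identities $d\mu_i=-\iota_{X_i}\omega$ are meant in the coordinates $(\varphi,x,y,z)$ over $U$. *)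

theory Defs
  imports "HOL-Analysis.Analysis"
begin

section \<open>Smooth manifolds and tensor fields given by an atlas\<close>

text \<open>Meant for open sets \<open>S\<close>.\<close>

fun Ck_on :: "nat \<Rightarrow> 'a::euclidean_space set \<Rightarrow> ('a \<Rightarrow> 'b::euclidean_space) \<Rightarrow> bool" where
  "Ck_on 0 S f \<longleftrightarrow> continuous_on S f"
| "Ck_on (Suc k) S f \<longleftrightarrow>
     f differentiable_on S \<and> (\<forall>v. Ck_on k S (\<lambda>x. frechet_derivative f (at x) v))"

definition smooth_on :: "'a::euclidean_space set \<Rightarrow> ('a \<Rightarrow> 'b::euclidean_space) \<Rightarrow> bool" where
  "smooth_on S f \<longleftrightarrow> (\<forall>k. Ck_on k S f)"

type_synonym ('m, 'e) chart = "'m set \<times> ('m \<Rightarrow> 'e)"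

text \<open>Smoothness of a map from an open set \<open>W\<close> of a Euclidean space into the manifold with
  topology \<open>X\<close> and atlas \<open>A\<close>.\<close>

definition smooth_into ::
  "'m topology \<Rightarrow> ('m, 'e::euclidean_space) chart set \<Rightarrow> 'a::euclidean_space set \<Rightarrow> ('a \<Rightarrow> 'm) \<Rightarrow> bool"
  where "smooth_into X A W \<Phi> \<longleftrightarrow>
    continuous_map (top_of_set W) X \<Phi> \<and>
    (\<forall>(D, f)\<in>A. smooth_on {p \<in> W. \<Phi> p \<in> D} (f \<circ> \<Phi>))"

text \<open>The dimension is that of the model space \<open>'e\<close>; smoothness of the transition maps is
  smoothness of the inverse charts.\<close>

definition smooth_manifold :: "'m topology \<Rightarrow> ('m, 'e::euclidean_space) chart set \<Rightarrow> bool" where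
  "smooth_manifold X A \<longleftrightarrow>
    Hausdorff_space X \<and> second_countable X \<and>
    (\<forall>(D, f)\<in>A. openin X D \<and> open (f ` D) \<and>
       homeomorphic_map (subtopology X D) (top_of_set (f ` D)) f) \<and>
    (\<Union>(D, f)\<in>A. D) = topspace X \<and>
    (\<forall>(D, f)\<in>A. smooth_into X A (f ` D) (inv_into D f))"

definition smooth_from ::
  "('m, 'e::euclidean_space) chart set \<Rightarrow> ('m \<Rightarrow> 'b::euclidean_space) \<Rightarrow> bool" where
  "smooth_from A h \<longleftrightarrow> (\<forall>(D, f)\<in>A. smooth_on (f ` D) (h \<circ> inv_into D f))"

text \<open>A tensor field on a manifold is the family of its coordinate expressions, one for each
  chart of the atlas; only the values of the expression for \<open>(D, f)\<close> on \<open>f ` D\<close> matter.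
  The next two definitions say that \<open>\<theta>'\<close>, \<open>b'\<close> is on \<open>W\<close> the pullback by \<open>\<Phi>\<close> of a
  covector field \<open>\<theta>\<close>, respectively a bilinear field \<open>b\<close>.\<close>

definition pulls_back1 ::
  "('m, 'e::euclidean_space) chart set \<Rightarrow> (('m, 'e) chart \<Rightarrow> 'e \<Rightarrow> 'e \<Rightarrow> real) \<Rightarrow>
   'a::euclidean_space set \<Rightarrow> ('a \<Rightarrow> 'm) \<Rightarrow> ('a \<Rightarrow> 'a \<Rightarrow> real) \<Rightarrow> bool" where
  "pulls_back1 A \<theta> W \<Phi> \<theta>' \<longleftrightarrow>
    (\<forall>(D, f)\<in>A. \<forall>p\<in>W. \<Phi> p \<in> D \<longrightarrow>
      (\<forall>u. \<theta>' p u = \<theta> (D, f) (f (\<Phi> p)) (frechet_derivative (f \<circ> \<Phi>) (at p) u)))"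

definition pulls_back2 ::
  "('m, 'e::euclidean_space) chart set \<Rightarrow> (('m, 'e) chart \<Rightarrow> 'e \<Rightarrow> 'e \<Rightarrow> 'e \<Rightarrow> real) \<Rightarrow>
   'a::euclidean_space set \<Rightarrow> ('a \<Rightarrow> 'm) \<Rightarrow> ('a \<Rightarrow> 'a \<Rightarrow> 'a \<Rightarrow> real) \<Rightarrow> bool" where
  "pulls_back2 A b W \<Phi> b' \<longleftrightarrow>
    (\<forall>(D, f)\<in>A. \<forall>p\<in>W. \<Phi> p \<in> D \<longrightarrow>
      (\<forall>u v. b' p u v =
        b (D, f) (f (\<Phi> p)) (frechet_derivative (f \<circ> \<Phi>) (at p) u)
          (frechet_derivative (f \<circ> \<Phi>) (at p) v)))"

text \<open>Smooth 1-forms on the open subset \<open>S\<close> of the manifold.\<close>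

definition one_form_on ::
  "('m, 'e::euclidean_space) chart set \<Rightarrow> 'm set \<Rightarrow> (('m, 'e) chart \<Rightarrow> 'e \<Rightarrow> 'e \<Rightarrow> real) \<Rightarrow> bool" where
  "one_form_on A S \<theta> \<longleftrightarrow>
    (\<forall>(D, f)\<in>A.
      (\<forall>p\<in>f ` (D \<inter> S). linear (\<theta> (D, f) p)) \<and>
      (\<forall>u. smooth_on (f ` (D \<inter> S)) (\<lambda>p. \<theta> (D, f) p u)) \<and>
      pulls_back1 A \<theta> (f ` (D \<inter> S)) (inv_into D f) (\<theta> (D, f)))"

definition bilinear_field ::
  "('m, 'e::euclidean_space) chart set \<Rightarrow> (('m, 'e) chart \<Rightarrow> 'e \<Rightarrow> 'e \<Rightarrow> 'e \<Rightarrow> real) \<Rightarrow> bool" where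
  "bilinear_field A b \<longleftrightarrow>
    (\<forall>(D, f)\<in>A.
      (\<forall>p\<in>f ` D. bilinear (b (D, f) p)) \<and>
      (\<forall>u v. smooth_on (f ` D) (\<lambda>p. b (D, f) p u v)) \<and>
      pulls_back2 A b (f ` D) (inv_into D f) (b (D, f)))"

definition riemannian_metric ::
  "('m, 'e::euclidean_space) chart set \<Rightarrow> (('m, 'e) chart \<Rightarrow> 'e \<Rightarrow> 'e \<Rightarrow> 'e \<Rightarrow> real) \<Rightarrow> bool" where
  "riemannian_metric A g \<longleftrightarrow> bilinear_field A g \<and>
    (\<forall>(D, f)\<in>A. \<forall>p\<in>f ` D.
      (\<forall>u v. g (D, f) p u v = g (D, f) p v u) \<and> (\<forall>u. u \<noteq> 0 \<longrightarrow> g (D, f) p u u > 0))"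

definition two_form ::
  "('m, 'e::euclidean_space) chart set \<Rightarrow> (('m, 'e) chart \<Rightarrow> 'e \<Rightarrow> 'e \<Rightarrow> 'e \<Rightarrow> real) \<Rightarrow> bool" where
  "two_form A \<omega> \<longleftrightarrow> bilinear_field A \<omega> \<and>
    (\<forall>(D, f)\<in>A. \<forall>p\<in>f ` D. \<forall>u v. \<omega> (D, f) p u v = - \<omega> (D, f) p v u)"

definition endomorphism_field ::
  "('m, 'e::euclidean_space) chart set \<Rightarrow> (('m, 'e) chart \<Rightarrow> 'e \<Rightarrow> 'e \<Rightarrow> 'e) \<Rightarrow> bool" where
  "endomorphism_field A J \<longleftrightarrow>
    (\<forall>(D, f)\<in>A.
      (\<forall>p\<in>f ` D. linear (J (D, f) p)) \<and>
      (\<forall>u. smooth_on (f ` D) (\<lambda>p. J (D, f) p u)) \<and>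
      (\<forall>(D', f')\<in>A. \<forall>m\<in>D \<inter> D'. \<forall>u.
        frechet_derivative (f' \<circ> inv_into D f) (at (f m)) (J (D, f) (f m) u) =
        J (D', f') (f' m) (frechet_derivative (f' \<circ> inv_into D f) (at (f m)) u)))"

text \<open>Almost complex structures \<open>J\<close> compatible with \<open>g\<close> and \<open>\<omega>\<close>, with the convention
  \<open>\<omega>(u, v) = g(J u, v)\<close>.\<close>

definition compatible_complex_structure ::
  "('m, 'e::euclidean_space) chart set \<Rightarrow> (('m, 'e) chart \<Rightarrow> 'e \<Rightarrow> 'e \<Rightarrow> 'e \<Rightarrow> real) \<Rightarrow>
   (('m, 'e) chart \<Rightarrow> 'e \<Rightarrow> 'e \<Rightarrow> 'e) \<Rightarrow> (('m, 'e) chart \<Rightarrow> 'e \<Rightarrow> 'e \<Rightarrow> 'e \<Rightarrow> real) \<Rightarrow> bool" where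
  "compatible_complex_structure A g J \<omega> \<longleftrightarrow> endomorphism_field A J \<and>
    (\<forall>(D, f)\<in>A. \<forall>p\<in>f ` D.
      (\<forall>u. J (D, f) p (J (D, f) p u) = - u) \<and>
      (\<forall>u v. \<omega> (D, f) p u v = g (D, f) p (J (D, f) p u) v))"


section \<open>The Gibbons-Hawking ansatz in coordinates\<close>

type_synonym R3 = "real \<times> real \<times> real"

text \<open>Coordinates \<open>(\<phi>, x, y, z)\<close>. The angular coordinate ranges over all of \<open>\<real>\<close> and parametrises
  the circle by \<open>exp(i \<phi>)\<close>.\<close>

type_synonym coords = "real \<times> R3"

definition gh_r :: "(nat \<Rightarrow> real) \<Rightarrow> nat \<Rightarrow> R3 \<Rightarrow> real" where
  "gh_r c j = (\<lambda>(x, y, z). sqrt (x\<^sup>2 + y\<^sup>2 + (z - c j)\<^sup>2))"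

definition gh_V :: "nat \<Rightarrow> (nat \<Rightarrow> real) \<Rightarrow> R3 \<Rightarrow> real" where
  "gh_V n c q = 1/2 * (\<Sum>j=1..n. 1 / gh_r c j q)"

definition gh_points :: "nat \<Rightarrow> (nat \<Rightarrow> real) \<Rightarrow> R3 set" where
  "gh_points n c = (\<lambda>j. (0, 0, c j)) ` {1..n}"

definition gh_U :: "(nat \<Rightarrow> real) \<Rightarrow> R3 set" where
  "gh_U c = - {(0, 0, z) | z. z \<ge> c 1}"

definition gh_alpha :: "nat \<Rightarrow> (nat \<Rightarrow> real) \<Rightarrow> R3 \<Rightarrow> R3 \<Rightarrow> real" where
  "gh_alpha n c = (\<lambda>(x, y, z) (dx, dy, dz).
     - 1/2 * (\<Sum>j=1..n. (x * dy - y * dx) /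
        (gh_r c j (x, y, z) * (gh_r c j (x, y, z) - (z - c j)))))"

definition d\<phi> :: "coords \<Rightarrow> real" where "d\<phi> = (\<lambda>(u0, u1, u2, u3). u0)"
definition dx :: "coords \<Rightarrow> real" where "dx = (\<lambda>(u0, u1, u2, u3). u1)"
definition dy :: "coords \<Rightarrow> real" where "dy = (\<lambda>(u0, u1, u2, u3). u2)"
definition dz :: "coords \<Rightarrow> real" where "dz = (\<lambda>(u0, u1, u2, u3). u3)"

definition wedge :: "('a \<Rightarrow> real) \<Rightarrow> ('a \<Rightarrow> real) \<Rightarrow> 'a \<Rightarrow> 'a \<Rightarrow> real" where
  "wedge a b u v = a u * b v - a v * b u"

text \<open>\<open>d\<phi> + \<beta>\<close> and the tensors \<open>g\<close>, \<open>\<omega>\<close> built from it, for a 1-form \<open>\<beta>\<close> on an open set of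
  \<open>\<real>\<^sup>3\<close>.\<close>

definition gh_conn :: "(R3 \<Rightarrow> R3 \<Rightarrow> real) \<Rightarrow> coords \<Rightarrow> coords \<Rightarrow> real" where
  "gh_conn \<beta> p u = d\<phi> u + \<beta> (snd p) (snd u)"

definition gh_metric ::
  "nat \<Rightarrow> (nat \<Rightarrow> real) \<Rightarrow> (R3 \<Rightarrow> R3 \<Rightarrow> real) \<Rightarrow> coords \<Rightarrow> coords \<Rightarrow> coords \<Rightarrow> real" where
  "gh_metric n c \<beta> p u v =
     1 / gh_V n c (snd p) * (gh_conn \<beta> p u * gh_conn \<beta> p v)
     + gh_V n c (snd p) * (dx u * dx v + dy u * dy v + dz u * dz v)"

definition gh_form ::
  "nat \<Rightarrow> (nat \<Rightarrow> real) \<Rightarrow> (R3 \<Rightarrow> R3 \<Rightarrow> real) \<Rightarrow> coords \<Rightarrow> coords \<Rightarrow> coords \<Rightarrow> real" where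
  "gh_form n c \<beta> p u v = wedge (gh_conn \<beta> p) dz u v + gh_V n c (snd p) * wedge dx dy u v"

definition ext_deriv1 :: "(R3 \<Rightarrow> R3 \<Rightarrow> real) \<Rightarrow> R3 \<Rightarrow> R3 \<Rightarrow> R3 \<Rightarrow> real" where
  "ext_deriv1 \<beta> q u v =
     frechet_derivative (\<lambda>q. \<beta> q v) (at q) u - frechet_derivative (\<lambda>q. \<beta> q u) (at q) v"

text \<open>The Hodge star of a covector \<open>a\<close> on oriented Euclidean \<open>\<real>\<^sup>3\<close>:
  \<open>*dx = dy \<and> dz\<close>, \<open>*dy = dz \<and> dx\<close>, \<open>*dz = dx \<and> dy\<close>.\<close>

definition hodge_star1 :: "(R3 \<Rightarrow> real) \<Rightarrow> R3 \<Rightarrow> R3 \<Rightarrow> real" where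
  "hodge_star1 a = (\<lambda>(u1, u2, u3) (v1, v2, v3).
     a (1, 0, 0) * (u2 * v3 - u3 * v2) + a (0, 1, 0) * (u3 * v1 - u1 * v3)
     + a (0, 0, 1) * (u1 * v2 - u2 * v1))"

definition local_connection :: "nat \<Rightarrow> (nat \<Rightarrow> real) \<Rightarrow> R3 set \<Rightarrow> (R3 \<Rightarrow> R3 \<Rightarrow> real) \<Rightarrow> bool" where
  "local_connection n c W \<beta> \<longleftrightarrow>
     (\<forall>q\<in>W. linear (\<beta> q)) \<and> (\<forall>u. smooth_on W (\<lambda>q. \<beta> q u)) \<and>
     (\<forall>q\<in>W. \<forall>u v. ext_deriv1 \<beta> q u v =
        - hodge_star1 (frechet_derivative (gh_V n c) (at q)) u v)"

text \<open>The torus action in the coordinates over \<open>U\<close>.\<close>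

definition torus_coords :: "real \<Rightarrow> real \<Rightarrow> coords \<Rightarrow> coords" where
  "torus_coords s t = (\<lambda>(\<phi>, x, y, z).
     (\<phi> + s, x * cos t - y * sin t, x * sin t + y * cos t, z))"


section \<open>Toric Gibbons-Hawking spaces\<close>

text \<open>\<open>\<Psi>\<close> is a local trivialisation of \<open>\<pi>\<close> over \<open>W\<close>, in coordinates \<open>(\<phi>, x, y, z)\<close> with
  \<open>\<phi>\<close> taken modulo \<open>2\<pi>\<close>, in which the connection \<open>\<theta>\<close> and the tensors \<open>g\<close>, \<open>\<omega>\<close> have the
  Gibbons-Hawking form with local connection form \<open>\<beta>\<close>.\<close>

definition gh_trivialisation ::
  "nat \<Rightarrow> (nat \<Rightarrow> real) \<Rightarrow> 'm topology \<Rightarrow> ('m, coords) chart set \<Rightarrow> ('m \<Rightarrow> R3) \<Rightarrow>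
   (complex \<times> complex \<Rightarrow> 'm \<Rightarrow> 'm) \<Rightarrow>
   (('m, coords) chart \<Rightarrow> coords \<Rightarrow> coords \<Rightarrow> real) \<Rightarrow>
   (('m, coords) chart \<Rightarrow> coords \<Rightarrow> coords \<Rightarrow> coords \<Rightarrow> real) \<Rightarrow>
   (('m, coords) chart \<Rightarrow> coords \<Rightarrow> coords \<Rightarrow> coords \<Rightarrow> real) \<Rightarrow>
   R3 set \<Rightarrow> (R3 \<Rightarrow> R3 \<Rightarrow> real) \<Rightarrow> (coords \<Rightarrow> 'm) \<Rightarrow> bool" where
  "gh_trivialisation n c X A pr act \<theta> g \<omega> W \<beta> \<Psi> \<longleftrightarrow>
     open W \<and> W \<inter> gh_points n c = {} \<and> local_connection n c W \<beta> \<and>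
     smooth_into X A (UNIV \<times> W) \<Psi> \<and>
     (\<forall>(D, f)\<in>A. \<forall>p\<in>UNIV \<times> W. \<Psi> p \<in> D \<longrightarrow> bij (frechet_derivative (f \<circ> \<Psi>) (at p))) \<and>
     \<Psi> ` (UNIV \<times> W) = {m \<in> topspace X. pr m \<in> W} \<and>
     (\<forall>\<phi>. \<forall>q\<in>W. pr (\<Psi> (\<phi>, q)) = q) \<and>
     (\<forall>\<phi> \<phi>'. \<forall>q\<in>W. \<Psi> (\<phi>, q) = \<Psi> (\<phi>', q) \<longleftrightarrow> (\<exists>k::int. \<phi>' = \<phi> + 2 * pi * of_int k)) \<and>
     (\<forall>s \<phi>. \<forall>q\<in>W. act (cis s, 1) (\<Psi> (\<phi>, q)) = \<Psi> (\<phi> + s, q)) \<and>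
     pulls_back1 A \<theta> (UNIV \<times> W) \<Psi> (gh_conn \<beta>) \<and>
     pulls_back2 A g (UNIV \<times> W) \<Psi> (gh_metric n c \<beta>) \<and>
     pulls_back2 A \<omega> (UNIV \<times> W) \<Psi> (gh_form n c \<beta>)"

text \<open>The underlying set of the manifold is \<open>topspace X\<close>, and \<open>pr\<close> is the map \<open>\<pi> = (x, y, z)\<close>.
  The torus acts by pairs of complex numbers of modulus 1; the circle action of the bundle is that
  of the first factor. The parametrisation \<open>\<Phi>\<close> provides the coordinates \<open>(\<phi>, x, y, z)\<close>
  over \<open>U\<close>. Smooth extendability of \<open>g\<close> and \<open>\<omega>\<close> over the fixed points is
  expressed by taking \<open>g\<close> and \<open>\<omega>\<close> as smooth tensor fields on the whole manifold.\<close>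

locale toric_gibbons_hawking =
  fixes n :: nat and c :: "nat \<Rightarrow> real"
    and X :: "'m topology" and A :: "('m, coords) chart set"
    and pr :: "'m \<Rightarrow> R3"
    and act :: "complex \<times> complex \<Rightarrow> 'm \<Rightarrow> 'm"
    and \<theta> :: "('m, coords) chart \<Rightarrow> coords \<Rightarrow> coords \<Rightarrow> real"
    and g :: "('m, coords) chart \<Rightarrow> coords \<Rightarrow> coords \<Rightarrow> coords \<Rightarrow> real"
    and J :: "('m, coords) chart \<Rightarrow> coords \<Rightarrow> coords \<Rightarrow> coords"
    and \<omega> :: "('m, coords) chart \<Rightarrow> coords \<Rightarrow> coords \<Rightarrow> coords \<Rightarrow> real"
    and \<Phi> :: "coords \<Rightarrow> 'm"
  assumes manifold: "smooth_manifold X A"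
    and pr_smooth: "smooth_from A pr"
    and act_closed: "\<And>s t m. norm s = 1 \<Longrightarrow> norm t = 1 \<Longrightarrow> m \<in> topspace X \<Longrightarrow>
        act (s, t) m \<in> topspace X"
    and act_one: "\<And>m. m \<in> topspace X \<Longrightarrow> act (1, 1) m = m"
    and act_mult: "\<And>s t s' t' m. norm s = 1 \<Longrightarrow> norm t = 1 \<Longrightarrow> norm s' = 1 \<Longrightarrow> norm t' = 1 \<Longrightarrow>
        m \<in> topspace X \<Longrightarrow> act (s * s', t * t') m = act (s, t) (act (s', t') m)"
    and act_smooth: "\<And>D f. (D, f) \<in> A \<Longrightarrow>
        smooth_into X A (UNIV \<times> UNIV \<times> f ` D)
          (\<lambda>(s, t, p). act (cis s, cis t) (inv_into D f p))"
    and fixed_points: "\<And>q. q \<in> gh_points n c \<Longrightarrow>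
        \<exists>m. {m' \<in> topspace X. pr m' = q} = {m} \<and> (\<forall>s. norm s = 1 \<longrightarrow> act (s, 1) m = m)"
    and connection: "one_form_on A {m \<in> topspace X. pr m \<notin> gh_points n c} \<theta>"
    and metric: "riemannian_metric A g"
    and form: "two_form A \<omega>"
    and complex_structure: "compatible_complex_structure A g J \<omega>"
    and trivialisations: "\<And>q. q \<notin> gh_points n c \<Longrightarrow>
        \<exists>W \<beta> \<Psi>. q \<in> W \<and> gh_trivialisation n c X A pr act \<theta> g \<omega> W \<beta> \<Psi>"
    and coordinates: "gh_trivialisation n c X A pr act \<theta> g \<omega> (gh_U c) (gh_alpha n c) \<Phi>"
    and act_coordinates: "\<And>s t p. p \<in> UNIV \<times> gh_U c \<Longrightarrow>
        act (cis s, cis t) (\<Phi> p) = \<Phi> (torus_coords s t p)"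


section \<open>Moment maps\<close>

definition X1 :: "coords \<Rightarrow> coords" where
  "X1 = (\<lambda>(\<phi>, x, y, z). (1, 0, 0, 0))"

definition X2 :: "coords \<Rightarrow> coords" where
  "X2 = (\<lambda>(\<phi>, x, y, z). (0, - y, x, 0))"

definition interior_product ::
  "('a \<Rightarrow> 'a) \<Rightarrow> ('a \<Rightarrow> 'a \<Rightarrow> 'a \<Rightarrow> real) \<Rightarrow> 'a \<Rightarrow> 'a \<Rightarrow> real" where
  "interior_product Y \<sigma> p v = \<sigma> p (Y p) v"

definition moment_map_on ::
  "'a::euclidean_space set \<Rightarrow> ('a \<Rightarrow> 'a \<Rightarrow> 'a \<Rightarrow> real) \<Rightarrow> ('a \<Rightarrow> 'a) \<Rightarrow> ('a \<Rightarrow> 'a) \<Rightarrow>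
   ('a \<Rightarrow> real \<times> real) \<Rightarrow> bool" where
  "moment_map_on S \<sigma> Y1 Y2 \<mu> \<longleftrightarrow>
    (\<forall>p\<in>S.
      ((\<lambda>q. fst (\<mu> q)) has_derivative (\<lambda>v. - interior_product Y1 \<sigma> p v)) (at p) \<and>
      ((\<lambda>q. snd (\<mu> q)) has_derivative (\<lambda>v. - interior_product Y2 \<sigma> p v)) (at p))"

definition gh_moment :: "nat \<Rightarrow> (nat \<Rightarrow> real) \<Rightarrow> R3 \<Rightarrow> real \<times> real" where
  "gh_moment n c = (\<lambda>(x, y, z). (- z, 1/2 * (\<Sum>j=1..n. gh_r c j (x, y, z) + z - c j)))"

end

theory Submission
  imports Defs
begin

text \<open>
  The map \<open>\<pi>\<close> is onto \<open>\<real>\<^sup>3\<close>: the trivialisations cover the complement of the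
  points \<open>p\<^sub>j\<close>, and the fixed points lie over these. Hence \<open>\<mu>\<close> and \<open>gh_moment n c\<close> have the
  same image. In the coordinates \<open>\<Phi>\<close>, moreover, \<open>\<pi>\<close> is the projection to \<open>(x, y, z)\<close>, so all
  that remains is calculus and combinatorics on \<open>\<real>\<^sup>3\<close>.

  \<^item> Moment map. The identity \<open>x\<^sup>2 + y\<^sup>2 = (r\<^sub>j - (z - c\<^sub>j)) (r\<^sub>j + (z - c\<^sub>j))\<close> cancels the
    denominator of \<open>\<alpha>(X\<^sub>2)\<close>, which becomes \<open>-1/2 \<Sum>\<^sub>j (r\<^sub>j + z - c\<^sub>j) / r\<^sub>j\<close>
    (\<open>gh_alpha_rotation\<close>). This is minus the \<open>z\<close>-derivative of \<open>\<mu>\<^sub>2\<close>, while the part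
    \<open>V dx \<and> dy\<close> of \<open>\<omega>\<close> accounts for the \<open>x\<close>- and \<open>y\<close>-derivatives
    (\<open>gh_moment_map\<close>).

  \<^item> Image. On a horizontal plane \<open>z = const\<close>, that is, \<open>\<mu>\<^sub>1 = const\<close>, the value \<open>\<mu>\<^sub>2\<close>
    is a continuous function of the distance from the axis. On the axis it equals
    \<open>\<Sum>\<^sub>j max 0 (z - c\<^sub>j)\<close>, which is its minimum on the plane; away from the axis it is unbounded,
    so it takes exactly the values above the minimum (\<open>range_gh_moment\<close>). As the \<open>c\<^sub>j\<close> increase,
    the positive terms \<open>z - c\<^sub>j\<close> form an initial segment, so this minimum is the largest of the
    partial sums \<open>\<Sum>\<^sub>j\<^sub>\<le>\<^sub>k (z - c\<^sub>j)\<close> (\<open>sum_max_0_le_iff\<close>), and lying above it is the stated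
    system of linear inequalities, a finite intersection of half-planes.
\<close>

section \<open>The torus action\<close>

lemma torus_coords_generators:
  "((\<lambda>t. torus_coords t 0 p) has_vector_derivative X1 p) (at 0)"
  "((\<lambda>t. torus_coords 0 t p) has_vector_derivative X2 p) (at 0)"
proof -
  obtain \<phi> x y z where p: "p = (\<phi>, x, y, z)" by (cases p) auto
  show "((\<lambda>t. torus_coords t 0 p) has_vector_derivative X1 p) (at 0)"
    unfolding p torus_coords_def X1_def has_vector_derivative_def
    by (auto intro!: derivative_eq_intros simp: fun_eq_iff zero_prod_def)
  show "((\<lambda>t. torus_coords 0 t p) has_vector_derivative X2 p) (at 0)"
    unfolding p torus_coords_def X2_def has_vector_derivative_def prod.case
    by (rule derivative_eq_intros refl | simp add: fun_eq_iff zero_prod_def)+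
qed


section \<open>The moment map equations\<close>

text \<open>Both factors vanish only on the half-line \<open>{(0, 0, z) | z \<ge> c j}\<close>, which lies in the
  half-line removed from \<open>\<real>\<^sup>3\<close>, because \<open>c 1\<close> is the smallest of the \<open>c j\<close>.\<close>

lemma gh_r_nonzero_on_U:
  assumes "strict_mono_on {1..n} c" "j \<in> {1..n}" "(x, y, z) \<in> gh_U c"
  shows "gh_r c j (x, y, z) > 0" "gh_r c j (x, y, z) - (z - c j) > 0"
proof -
  have c1: "c 1 \<le> c j"
    using strict_mono_on_leD[OF assms(1), of 1 j] assms(2) by auto
  have off_axis: "x\<^sup>2 + y\<^sup>2 > 0 \<or> z < c j"
    using assms(3) c1 by (auto simp: gh_U_def sum_power2_gt_zero_iff)
  show "gh_r c j (x, y, z) > 0"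
    using off_axis by (auto simp: gh_r_def intro: add_pos_nonneg add_nonneg_pos)
  have "z - c j < sqrt (x\<^sup>2 + y\<^sup>2 + (z - c j)\<^sup>2)"
  proof (cases "z < c j")
    case True
    then show ?thesis by (smt (verit) real_sqrt_ge_zero sum_power2_ge_zero zero_le_power2)
  next
    case False
    then show ?thesis using off_axis by (intro real_less_rsqrt) auto
  qed
  then show "gh_r c j (x, y, z) - (z - c j) > 0"
    by (simp add: gh_r_def)
qed

text \<open>The rotation field gives \<open>x dy - y dx\<close> the value \<open>x\<^sup>2 + y\<^sup>2 = r\<^sub>j\<^sup>2 - (z - c\<^sub>j)\<^sup>2\<close>,
  which contains the factor \<open>r\<^sub>j - (z - c\<^sub>j)\<close> of the denominator. The remaining quotient
  \<open>(r\<^sub>j + z - c\<^sub>j) / r\<^sub>j\<close> is the \<open>z\<close>-derivative of \<open>r\<^sub>j + z - c\<^sub>j\<close>.\<close>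

lemma gh_alpha_rotation:
  assumes "strict_mono_on {1..n} c" "(x, y, z) \<in> gh_U c"
  shows "gh_alpha n c (x, y, z) (- y, x, 0) =
    - 1/2 * (\<Sum>j=1..n. (gh_r c j (x, y, z) + z - c j) / gh_r c j (x, y, z))"
proof -
  have "(x * x - y * - y) / (gh_r c j (x, y, z) * (gh_r c j (x, y, z) - (z - c j))) =
      (gh_r c j (x, y, z) + z - c j) / gh_r c j (x, y, z)" if "j \<in> {1..n}" for j
  proof -
    let ?r = "gh_r c j (x, y, z)"
    have pos: "?r > 0" "?r - (z - c j) > 0"
      using gh_r_nonzero_on_U[OF assms(1) that assms(2)] by auto
    have "?r\<^sup>2 = x\<^sup>2 + y\<^sup>2 + (z - c j)\<^sup>2"
      by (simp add: gh_r_def)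
    then have "x * x - y * - y = (?r + z - c j) * (?r - (z - c j))"
      by (simp add: power2_eq_square algebra_simps)
    then show ?thesis
      using pos by simp
  qed
  then show ?thesis
    by (simp add: gh_alpha_def)
qed

lemma gh_r_has_derivative:
  assumes "gh_r c j (x, y, z) > 0"
  shows "((\<lambda>p::coords. gh_r c j (snd p)) has_derivative
    (\<lambda>v. (x * dx v + y * dy v + (z - c j) * dz v) / gh_r c j (x, y, z))) (at (\<phi>, x, y, z))"
proof -
  have pos: "0 < x\<^sup>2 + y\<^sup>2 + (z - c j)\<^sup>2"
    using assms by (simp add: gh_r_def)
  show ?thesis
    unfolding gh_r_def split_beta dx_def dy_def dz_def
    using pos by (auto intro!: derivative_eq_intros simp: fun_eq_iff field_simps)
qed

lemma gh_moment_has_derivative: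
  assumes "\<And>j. j \<in> {1..n} \<Longrightarrow> gh_r c j (x, y, z) > 0"
  shows "((\<lambda>p::coords. fst (gh_moment n c (snd p))) has_derivative (\<lambda>v. - dz v)) (at (\<phi>, x, y, z))"
    and "((\<lambda>p::coords. snd (gh_moment n c (snd p))) has_derivative
      (\<lambda>v. gh_V n c (x, y, z) * (x * dx v + y * dy v)
        + 1/2 * (\<Sum>j=1..n. (gh_r c j (x, y, z) + z - c j) / gh_r c j (x, y, z)) * dz v))
      (at (\<phi>, x, y, z))"
proof -
  show "((\<lambda>p::coords. fst (gh_moment n c (snd p))) has_derivative (\<lambda>v. - dz v)) (at (\<phi>, x, y, z))"
    unfolding gh_moment_def split_beta dz_def
    by (auto intro!: derivative_eq_intros)
  have eq: "(\<lambda>p::coords. snd (gh_moment n c (snd p))) =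
      (\<lambda>p. 1/2 * (\<Sum>j=1..n. gh_r c j (snd p) + snd (snd (snd p)) - c j))"
    by (simp add: gh_moment_def split_beta)
  have "((\<lambda>p::coords. 1/2 * (\<Sum>j=1..n. gh_r c j (snd p) + snd (snd (snd p)) - c j)) has_derivative
      (\<lambda>v. 1/2 * (\<Sum>j=1..n.
        (x * dx v + y * dy v + (z - c j) * dz v) / gh_r c j (x, y, z) + snd (snd (snd v)) - 0)))
      (at (\<phi>, x, y, z))"
    by (intro has_derivative_mult_right has_derivative_sum has_derivative_diff has_derivative_add
        gh_r_has_derivative assms has_derivative_snd has_derivative_ident has_derivative_const)
  moreover have "1/2 * (\<Sum>j=1..n.
        (x * dx v + y * dy v + (z - c j) * dz v) / gh_r c j (x, y, z) + snd (snd (snd v)) - 0) =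
      gh_V n c (x, y, z) * (x * dx v + y * dy v)
        + 1/2 * (\<Sum>j=1..n. (gh_r c j (x, y, z) + z - c j) / gh_r c j (x, y, z)) * dz v" for v
  proof -
    have "(x * dx v + y * dy v + (z - c j) * dz v) / gh_r c j (x, y, z) + snd (snd (snd v)) - 0 =
        1 / gh_r c j (x, y, z) * (x * dx v + y * dy v)
        + (gh_r c j (x, y, z) + z - c j) / gh_r c j (x, y, z) * dz v" if "j \<in> {1..n}" for j
      using assms[OF that] by (simp add: dz_def split_beta field_simps)
    then show ?thesis
      by (simp add: gh_V_def sum.distrib sum_distrib_right distrib_left)
  qed
  ultimately show "((\<lambda>p::coords. snd (gh_moment n c (snd p))) has_derivative
      (\<lambda>v. gh_V n c (x, y, z) * (x * dx v + y * dy v)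
        + 1/2 * (\<Sum>j=1..n. (gh_r c j (x, y, z) + z - c j) / gh_r c j (x, y, z)) * dz v))
      (at (\<phi>, x, y, z))"
    unfolding eq by (simp only:)
qed

lemma gh_moment_map:
  assumes "strict_mono_on {1..n} c"
  shows "moment_map_on (UNIV \<times> gh_U c) (gh_form n c (gh_alpha n c)) X1 X2 (gh_moment n c \<circ> snd)"
  unfolding moment_map_on_def
proof
  fix p :: coords
  assume "p \<in> UNIV \<times> gh_U c"
  then obtain \<phi> x y z where p: "p = (\<phi>, x, y, z)" and U: "(x, y, z) \<in> gh_U c"
    by (metis SigmaE surj_pair)
  have pos: "gh_r c j (x, y, z) > 0" if "j \<in> {1..n}" for j
    using gh_r_nonzero_on_U(1)[OF assms that U] .
  have X1: "- interior_product X1 (gh_form n c (gh_alpha n c)) p v = - dz v" for v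
    by (simp add: p X1_def interior_product_def gh_form_def gh_conn_def wedge_def gh_alpha_def
        d\<phi>_def dx_def dy_def dz_def split_beta)
  have X2: "- interior_product X2 (gh_form n c (gh_alpha n c)) p v =
      gh_V n c (x, y, z) * (x * dx v + y * dy v)
        + 1/2 * (\<Sum>j=1..n. (gh_r c j (x, y, z) + z - c j) / gh_r c j (x, y, z)) * dz v" for v
  proof -
    have "interior_product X2 (gh_form n c (gh_alpha n c)) p v =
        gh_alpha n c (x, y, z) (- y, x, 0) * dz v + gh_V n c (x, y, z) * (- y * dy v - x * dx v)"
      by (simp add: p X2_def interior_product_def gh_form_def gh_conn_def wedge_def
          d\<phi>_def dx_def dy_def dz_def split_beta)
    then show ?thesis
      unfolding gh_alpha_rotation[OF assms U] by (simp add: algebra_simps)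
  qed
  show "((\<lambda>q. fst ((gh_moment n c \<circ> snd) q)) has_derivative
        (\<lambda>v. - interior_product X1 (gh_form n c (gh_alpha n c)) p v)) (at p) \<and>
      ((\<lambda>q. snd ((gh_moment n c \<circ> snd) q)) has_derivative
        (\<lambda>v. - interior_product X2 (gh_form n c (gh_alpha n c)) p v)) (at p)"
    unfolding X1 X2 unfolding p comp_apply by (intro conjI gh_moment_has_derivative pos)
qed

lemma moment_map_on_cong:
  assumes "open S" "moment_map_on S \<sigma> Y1 Y2 \<mu>" "\<And>p. p \<in> S \<Longrightarrow> \<mu>' p = \<mu> p"
  shows "moment_map_on S \<sigma> Y1 Y2 \<mu>'"
  unfolding moment_map_on_def
proof
  fix p assume p: "p \<in> S"
  have "((\<lambda>q. fst (\<mu> q)) has_derivative (\<lambda>v. - interior_product Y1 \<sigma> p v)) (at p)"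
    and "((\<lambda>q. snd (\<mu> q)) has_derivative (\<lambda>v. - interior_product Y2 \<sigma> p v)) (at p)"
    using assms(2) p unfolding moment_map_on_def by blast+
  then show "((\<lambda>q. fst (\<mu>' q)) has_derivative (\<lambda>v. - interior_product Y1 \<sigma> p v)) (at p) \<and>
      ((\<lambda>q. snd (\<mu>' q)) has_derivative (\<lambda>v. - interior_product Y2 \<sigma> p v)) (at p)"
    by (auto elim!: has_derivative_transform_within_open[OF _ assms(1) p] simp: assms(3))
qed


section \<open>The image\<close>

text \<open>A sum of positive parts dominates every partial sum, and for increasing \<open>c\<close> it is itself
  one of them, since its nonzero terms form an initial segment.\<close>

lemma sum_max_0_le_iff:
  fixes c :: "nat \<Rightarrow> real"
  assumes "mono_on {1..n} c"
  shows "(\<Sum>j=1..n. max 0 (z - c j)) \<le> m \<longleftrightarrow> (\<forall>k\<in>{0..n}. (\<Sum>j=1..k. z - c j) \<le> m)"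
proof -
  have attained: "\<exists>k\<in>{0..n}. (\<Sum>j=1..n. max 0 (z - c j)) = (\<Sum>j=1..k. z - c j)"
    using assms
  proof (induction n)
    case 0
    then show ?case by simp
  next
    case (Suc n)
    show ?case
    proof (cases "c (Suc n) \<le> z")
      case True
      have "max 0 (z - c j) = z - c j" if "j \<in> {1..Suc n}" for j
        using mono_onD[OF Suc.prems, of j "Suc n"] that True by simp
      then show ?thesis
        by (intro bexI[of _ "Suc n"]) (auto intro!: sum.cong simp del: sum.cl_ivl_Suc)
    next
      case False
      moreover have "mono_on {1..n} c"
        using Suc.prems by (rule mono_on_subset) auto
      then obtain k where "k \<in> {0..n}"
          "(\<Sum>j=1..n. max 0 (z - c j)) = (\<Sum>j=1..k. z - c j)"
        using Suc.IH by auto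
      ultimately show ?thesis
        by (intro bexI[of _ k]) auto
    qed
  qed
  have "(\<Sum>j=1..k. z - c j) \<le> (\<Sum>j=1..n. max 0 (z - c j))" if "k \<in> {0..n}" for k
  proof -
    have "(\<Sum>j=1..k. z - c j) \<le> (\<Sum>j=1..k. max 0 (z - c j))"
      by (intro sum_mono) auto
    also have "\<dots> \<le> (\<Sum>j=1..n. max 0 (z - c j))"
      using that by (intro sum_mono2) auto
    finally show ?thesis .
  qed
  with attained show ?thesis
    by (metis order_trans)
qed

text \<open>Each term satisfies \<open>r\<^sub>j + z - c\<^sub>j \<ge> \<bar>z - c\<^sub>j\<bar> + z - c\<^sub>j = 2 max 0 (z - c\<^sub>j)\<close>, with
  equality on the axis. Every larger value is reached on the ray \<open>(s, 0, z)\<close>, \<open>s \<ge> 0\<close>, by the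
  intermediate value theorem.\<close>

lemma range_gh_moment:
  assumes "n \<ge> 1"
  shows "range (gh_moment n c) = {(m1, m2). (\<Sum>j=1..n. max 0 (- m1 - c j)) \<le> m2}"
proof (intro equalityI subsetI)
  fix m assume "m \<in> range (gh_moment n c)"
  then obtain x y z where m: "m = gh_moment n c (x, y, z)"
    by (metis imageE surj_pair)
  have "2 * max 0 (z - c j) \<le> gh_r c j (x, y, z) + z - c j" for j
  proof -
    have "\<bar>z - c j\<bar> \<le> gh_r c j (x, y, z)"
      by (simp add: gh_r_def real_le_rsqrt)
    then show ?thesis by (auto simp: max_def)
  qed
  then have "(\<Sum>j=1..n. 2 * max 0 (z - c j)) \<le> (\<Sum>j=1..n. gh_r c j (x, y, z) + z - c j)"
    by (intro sum_mono)
  then show "m \<in> {(m1, m2). (\<Sum>j=1..n. max 0 (- m1 - c j)) \<le> m2}"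
    by (simp add: m gh_moment_def flip: sum_distrib_left)
next
  fix m :: "real \<times> real"
  assume "m \<in> {(m1, m2). (\<Sum>j=1..n. max 0 (- m1 - c j)) \<le> m2}"
  moreover define z m2 where "z = - fst m" and "m2 = snd m"
  ultimately have m: "m = (- z, m2)" and le: "(\<Sum>j=1..n. max 0 (z - c j)) \<le> m2"
    by auto
  define h where "h s = 1/2 * (\<Sum>j=1..n. sqrt (s\<^sup>2 + (z - c j)\<^sup>2) + z - c j)" for s
  have h0: "h 0 \<le> m2"
  proof -
    have "sqrt (0\<^sup>2 + (z - c j)\<^sup>2) + z - c j = 2 * max 0 (z - c j)" for j
      by (simp add: max_def)
    then have "h 0 = (\<Sum>j=1..n. max 0 (z - c j))"
      unfolding h_def by (simp flip: sum_distrib_left)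
    with le show ?thesis by simp
  qed
  \<comment> \<open>All terms of \<open>h s\<close> are nonnegative, so the first one alone can push it above \<open>m2\<close>.\<close>
  define s where "s = max 0 (2 * m2 - (z - c 1))"
  have hs: "m2 \<le> h s"
  proof -
    have "2 * m2 \<le> s + (z - c 1)"
      by (simp add: s_def)
    also have "\<dots> \<le> sqrt (s\<^sup>2 + (z - c 1)\<^sup>2) + z - c 1"
      by (simp add: real_le_rsqrt)
    also have "\<dots> \<le> (\<Sum>j=1..n. sqrt (s\<^sup>2 + (z - c j)\<^sup>2) + z - c j)"
    proof (rule member_le_sum)
      fix j
      have "\<bar>z - c j\<bar> \<le> sqrt (s\<^sup>2 + (z - c j)\<^sup>2)"
        by (simp add: real_le_rsqrt)
      then show "0 \<le> sqrt (s\<^sup>2 + (z - c j)\<^sup>2) + z - c j" by linarith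
    qed (use assms in auto)
    finally show ?thesis by (simp add: h_def)
  qed
  have "continuous_on {0..s} h"
    unfolding h_def by (intro continuous_intros)
  then obtain t where "h t = m2"
    using IVT'[of h 0 m2 s] h0 hs by (auto simp: s_def)
  then have "m = gh_moment n c (t, 0, z)"
    by (simp add: m gh_moment_def gh_r_def h_def)
  then show "m \<in> range (gh_moment n c)" by blast
qed

lemma convex_moment_region:
  fixes c :: "nat \<Rightarrow> real"
  shows
  "convex {(m1, m2). \<forall>k\<in>{0..n}. m2 + (\<Sum>j=1..k. m1 + c j) \<ge> 0}"
proof -
  have "m2 + (\<Sum>j=1..k. m1 + c j) \<ge> 0 \<longleftrightarrow> inner (real k, 1) (m1, m2) \<ge> - (\<Sum>j=1..k. c j)"
    for k m1 m2
    by (auto simp: sum.distrib inner_prod_def)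
  then have "{(m1, m2). \<forall>k\<in>{0..n}. m2 + (\<Sum>j=1..k. m1 + c j) \<ge> 0} =
      (\<Inter>k\<in>{0..n}. {m. inner (real k, 1) m \<ge> - (\<Sum>j=1..k. c j)})"
    by auto
  then show ?thesis
    by (auto intro!: convex_INT convex_halfspace_ge)
qed

lemma (in toric_gibbons_hawking) pr_surj: "pr ` topspace X = UNIV"
proof -
  have "\<exists>m\<in>topspace X. pr m = q" for q
  proof (cases "q \<in> gh_points n c")
    case True
    then show ?thesis using fixed_points[of q] by blast
  next
    case False
    then obtain W \<beta> \<Psi> where "q \<in> W" "gh_trivialisation n c X A pr act \<theta> g \<omega> W \<beta> \<Psi>"
      using trivialisations by blast
    then have "\<Psi> (0, q) \<in> topspace X" "pr (\<Psi> (0, q)) = q"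
      unfolding gh_trivialisation_def by auto
    then show ?thesis by blast
  qed
  then show ?thesis by (metis UNIV_eq_I image_eqI)
qed

theorem mainTheorem3:
  fixes n :: nat and c :: "nat \<Rightarrow> real"
    and X :: "'m topology" and A :: "('m, coords) chart set"
    and pr :: "'m \<Rightarrow> R3"
    and act :: "complex \<times> complex \<Rightarrow> 'm \<Rightarrow> 'm"
    and \<theta> :: "('m, coords) chart \<Rightarrow> coords \<Rightarrow> coords \<Rightarrow> real"
    and g :: "('m, coords) chart \<Rightarrow> coords \<Rightarrow> coords \<Rightarrow> coords \<Rightarrow> real"
    and J :: "('m, coords) chart \<Rightarrow> coords \<Rightarrow> coords \<Rightarrow> coords"
    and \<omega> :: "('m, coords) chart \<Rightarrow> coords \<Rightarrow> coords \<Rightarrow> coords \<Rightarrow> real"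
    and \<Phi> :: "coords \<Rightarrow> 'm"
    and \<mu> :: "'m \<Rightarrow> real \<times> real"
  assumes "n \<ge> 1"
    and "strict_mono_on {1..n} c"
    and "toric_gibbons_hawking n c X A pr act \<theta> g J \<omega> \<Phi>"
  defines "\<mu> \<equiv> gh_moment n c \<circ> pr"
  shows "(\<forall>p \<in> UNIV \<times> gh_U c.
            ((\<lambda>t. torus_coords t 0 p) has_vector_derivative X1 p) (at 0) \<and>
            ((\<lambda>t. torus_coords 0 t p) has_vector_derivative X2 p) (at 0)) \<and>
         moment_map_on (UNIV \<times> gh_U c) (gh_form n c (gh_alpha n c)) X1 X2 (\<mu> \<circ> \<Phi>) \<and>
         \<mu> ` topspace X =
           {(m1, m2). \<forall>k\<in>{0..n}. m2 + (\<Sum>j=1..k. m1 + c j) \<ge> 0} \<and>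
         convex {(m1, m2). \<forall>k\<in>{0..n}. m2 + (\<Sum>j=1..k. m1 + c j) \<ge> 0}"
proof -
  interpret toric_gibbons_hawking n c X A pr act \<theta> g J \<omega> \<Phi> by fact
  have "open (gh_U c)" and pr_\<Phi>: "\<And>\<phi> q. q \<in> gh_U c \<Longrightarrow> pr (\<Phi> (\<phi>, q)) = q"
    using coordinates unfolding gh_trivialisation_def by auto
  then have "moment_map_on (UNIV \<times> gh_U c) (gh_form n c (gh_alpha n c)) X1 X2 (\<mu> \<circ> \<Phi>)"
    by (intro moment_map_on_cong[OF _ gh_moment_map[OF assms(2)]] open_Times) (auto simp: \<mu>_def)
  moreover have "\<mu> ` topspace X = {(m1, m2). \<forall>k\<in>{0..n}. m2 + (\<Sum>j=1..k. m1 + c j) \<ge> 0}"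
  proof -
    have "\<mu> ` topspace X = range (gh_moment n c)"
      by (simp only: \<mu>_def pr_surj flip: image_comp)
    also have "\<dots> = {(m1, m2). \<forall>k\<in>{0..n}. (\<Sum>j=1..k. - m1 - c j) \<le> m2}"
      unfolding range_gh_moment[OF assms(1)]
        sum_max_0_le_iff[OF strict_mono_on_imp_mono_on[OF assms(2)]] ..
    also have "\<dots> = {(m1, m2). \<forall>k\<in>{0..n}. m2 + (\<Sum>j=1..k. m1 + c j) \<ge> 0}"
    proof -
      have neg: "(\<Sum>j=1..k. - m1 - c j) = - (\<Sum>j=1..k. m1 + c j)" for k m1
        by (simp add: sum_subtractf sum.distrib)
      show ?thesis
        unfolding neg by auto
    qed
    finally show ?thesis .
  qed
  ultimately show ?thesis
    using torus_coords_generators convex_moment_region by blast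
qed

end
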